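(* Let $G$ and $H$ be groups. If the comonads $K_G$ and $K_H$ are isomorphic in $\mathbf{Comonads}(\mathbf{Set})$, then the groups $G$ and $H$ are isomorphic.
   Context: For a group $G$, the comonad $K_G=(K_G,\epsilon^G,\delta^G)$ on $\mathbf{Set}$ is given by: $K_G(X)=X^G$, the set of all functions $G\to X$; $K_G(f)(\phi)=f\circ\phi$ for a map $f\colon X\to Y$; counit $\epsilon^G_X\colon X^G\to X$, $\epsilon^G_X(\phi)=\phi(e_G)$; comultiplication $\delta^G_X\colon X^G\to (X^G)^G$, $\delta^G_X(\phi)(g)(h)=\phi(gh)$. A morphism of comonads $(K,\epsilon,\delta)\to(K',\epsilon',\delta')$ on a category is a natural transformation $\phi\colon K\Rightarrow K'$ with $\epsilon'\circ\phi=\epsilon$ and $\delta'\circ\phi=(\phi\phi)\circ\delta$, where $\phi\phi\colon K^2\Rightarrow K'^2$ is the horizontal composite. $\mathbf{Comonads}(\mathbf{Set})$ is the category of comonads on $\mathbf{Set}$ and morphisms of comonads. *)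

theory Defs
  imports "HOL-Algebra.Group" "HOL-Library.Equipollence"
begin

section \<open>Categories\<close>

record ('o, 'a) cat =
  Obj :: "'o set"
  Arr :: "'a set"
  Dom :: "'a \<Rightarrow> 'o"
  Cod :: "'a \<Rightarrow> 'o"
  Id :: "'o \<Rightarrow> 'a"
  Comp :: "'a \<Rightarrow> 'a \<Rightarrow> 'a"

definition arrows :: "('o, 'a) cat \<Rightarrow> 'o \<Rightarrow> 'o \<Rightarrow> 'a set" where
  "arrows C X Y = {f \<in> Arr C. Dom C f = X \<and> Cod C f = Y}"

definition category :: "('o, 'a) cat \<Rightarrow> bool" where
  "category C \<longleftrightarrow>
     (\<forall>f\<in>Arr C. Dom C f \<in> Obj C \<and> Cod C f \<in> Obj C) \<and>
     (\<forall>X\<in>Obj C. Id C X \<in> arrows C X X) \<and>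
     (\<forall>f\<in>Arr C. \<forall>g\<in>Arr C. Cod C f = Dom C g \<longrightarrow>
        Comp C g f \<in> arrows C (Dom C f) (Cod C g)) \<and>
     (\<forall>f\<in>Arr C. Comp C f (Id C (Dom C f)) = f \<and> Comp C (Id C (Cod C f)) f = f) \<and>
     (\<forall>f\<in>Arr C. \<forall>g\<in>Arr C. \<forall>h\<in>Arr C. Cod C f = Dom C g \<longrightarrow> Cod C g = Dom C h \<longrightarrow>
        Comp C h (Comp C g f) = Comp C (Comp C h g) f)"

definition isomorphic_in :: "('o, 'a) cat \<Rightarrow> 'o \<Rightarrow> 'o \<Rightarrow> bool" where
  "isomorphic_in C X Y \<longleftrightarrow>
     (\<exists>f\<in>arrows C X Y. \<exists>g\<in>arrows C Y X. Comp C g f = Id C X \<and> Comp C f g = Id C Y)"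


section \<open>Endofunctors and natural transformations\<close>

text \<open>
  Functors and natural transformations take the value \<open>undefined\<close> outside the objects and
  arrows of the category, so that HOL equality is equality in the mathematical sense.
\<close>

record ('o, 'a) endofun =
  FObj :: "'o \<Rightarrow> 'o"
  FArr :: "'a \<Rightarrow> 'a"

definition endofunctor :: "('o, 'a) cat \<Rightarrow> ('o, 'a) endofun \<Rightarrow> bool" where
  "endofunctor C F \<longleftrightarrow>
     FObj F \<in> Obj C \<rightarrow>\<^sub>E Obj C \<and>
     FArr F \<in> extensional (Arr C) \<and>
     (\<forall>f\<in>Arr C. FArr F f \<in> arrows C (FObj F (Dom C f)) (FObj F (Cod C f))) \<and>
     (\<forall>X\<in>Obj C. FArr F (Id C X) = Id C (FObj F X)) \<and>
     (\<forall>f\<in>Arr C. \<forall>g\<in>Arr C. Cod C f = Dom C g \<longrightarrow>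
        FArr F (Comp C g f) = Comp C (FArr F g) (FArr F f))"

definition id_endofun :: "('o, 'a) cat \<Rightarrow> ('o, 'a) endofun" where
  "id_endofun C = \<lparr>FObj = (\<lambda>X\<in>Obj C. X), FArr = (\<lambda>f\<in>Arr C. f)\<rparr>"

definition comp_endofun ::
    "('o, 'a) cat \<Rightarrow> ('o, 'a) endofun \<Rightarrow> ('o, 'a) endofun \<Rightarrow> ('o, 'a) endofun" where
  "comp_endofun C T F =
     \<lparr>FObj = compose (Obj C) (FObj T) (FObj F), FArr = compose (Arr C) (FArr T) (FArr F)\<rparr>"

definition nat_trans ::
    "('o, 'a) cat \<Rightarrow> ('o, 'a) endofun \<Rightarrow> ('o, 'a) endofun \<Rightarrow> ('o \<Rightarrow> 'a) \<Rightarrow> bool" where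
  "nat_trans C F T \<tau> \<longleftrightarrow>
     \<tau> \<in> extensional (Obj C) \<and>
     (\<forall>X\<in>Obj C. \<tau> X \<in> arrows C (FObj F X) (FObj T X)) \<and>
     (\<forall>f\<in>Arr C. Comp C (\<tau> (Cod C f)) (FArr F f) = Comp C (FArr T f) (\<tau> (Dom C f)))"

definition vcomp :: "('o, 'a) cat \<Rightarrow> ('o \<Rightarrow> 'a) \<Rightarrow> ('o \<Rightarrow> 'a) \<Rightarrow> 'o \<Rightarrow> 'a" where
  "vcomp C \<tau> \<sigma> = (\<lambda>X\<in>Obj C. Comp C (\<tau> X) (\<sigma> X))"

text \<open>
  \<open>hcomp C T F' \<tau> \<sigma>\<close> is the horizontal composite \<open>T F \<Rightarrow> T' F'\<close> of
  \<open>\<sigma> : F \<Rightarrow> F'\<close> and \<open>\<tau> : T \<Rightarrow> T'\<close>.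
\<close>

definition hcomp ::
    "('o, 'a) cat \<Rightarrow> ('o, 'a) endofun \<Rightarrow> ('o, 'a) endofun \<Rightarrow> ('o \<Rightarrow> 'a) \<Rightarrow> ('o \<Rightarrow> 'a) \<Rightarrow> 'o \<Rightarrow> 'a"
  where "hcomp C T F' \<tau> \<sigma> = (\<lambda>X\<in>Obj C. Comp C (\<tau> (FObj F' X)) (FArr T (\<sigma> X)))"


section \<open>Comonads\<close>

record ('o, 'a) comonad_data =
  Fun :: "('o, 'a) endofun"
  counit :: "'o \<Rightarrow> 'a"
  comult :: "'o \<Rightarrow> 'a"

definition comonad :: "('o, 'a) cat \<Rightarrow> ('o, 'a) comonad_data \<Rightarrow> bool" where
  "comonad C K \<longleftrightarrow>
     endofunctor C (Fun K) \<and>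
     nat_trans C (Fun K) (id_endofun C) (counit K) \<and>
     nat_trans C (Fun K) (comp_endofun C (Fun K) (Fun K)) (comult K) \<and>
     (\<forall>X\<in>Obj C.
        Comp C (counit K (FObj (Fun K) X)) (comult K X) = Id C (FObj (Fun K) X) \<and>
        Comp C (FArr (Fun K) (counit K X)) (comult K X) = Id C (FObj (Fun K) X) \<and>
        Comp C (comult K (FObj (Fun K) X)) (comult K X) =
          Comp C (FArr (Fun K) (comult K X)) (comult K X))"

definition comonad_morphism ::
    "('o, 'a) cat \<Rightarrow> ('o, 'a) comonad_data \<Rightarrow> ('o, 'a) comonad_data \<Rightarrow> ('o \<Rightarrow> 'a) \<Rightarrow> bool" where
  "comonad_morphism C K K' \<phi> \<longleftrightarrow>
     nat_trans C (Fun K) (Fun K') \<phi> \<and>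
     vcomp C (counit K') \<phi> = counit K \<and>
     vcomp C (comult K') \<phi> = vcomp C (hcomp C (Fun K) (Fun K') \<phi> \<phi>) (comult K)"

text \<open>An arrow of the category of comonads is a triple (source, morphism, target).\<close>

definition Comonads ::
    "('o, 'a) cat \<Rightarrow>
     (('o, 'a) comonad_data,
      ('o, 'a) comonad_data \<times> ('o \<Rightarrow> 'a) \<times> ('o, 'a) comonad_data) cat" where
  "Comonads C =
     \<lparr>Obj = {K. comonad C K},
      Arr = {(K, \<phi>, K'). comonad C K \<and> comonad C K' \<and> comonad_morphism C K K' \<phi>},
      Dom = (\<lambda>(K, \<phi>, K'). K),
      Cod = (\<lambda>(K, \<phi>, K'). K'),
      Id = (\<lambda>K. (K, (\<lambda>X\<in>Obj C. Id C (FObj (Fun K) X)), K)),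
      Comp = (\<lambda>(K', \<psi>, K'') (K, \<phi>, _). (K, vcomp C \<psi> \<phi>, K''))\<rparr>"


section \<open>Categories of sets\<close>

text \<open>
  HOL has no type of all sets. The category of sets is therefore the category \<open>Sets U\<close> of
  all sets in a universe \<open>U\<close> (a collection of sets over an arbitrary type \<open>'u\<close>) and all
  functions between them; an arrow is a triple (source, function, target).
\<close>

definition Sets :: "'u set set \<Rightarrow> ('u set, 'u set \<times> ('u \<Rightarrow> 'u) \<times> 'u set) cat" where
  "Sets U =
     \<lparr>Obj = U,
      Arr = {(X, f, Y). X \<in> U \<and> Y \<in> U \<and> f \<in> X \<rightarrow>\<^sub>E Y},
      Dom = (\<lambda>(X, f, Y). X),
      Cod = (\<lambda>(X, f, Y). Y),
      Id = (\<lambda>X. (X, (\<lambda>x\<in>X. x), X)),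
      Comp = (\<lambda>(Y, g, Z) (X, f, _). (X, compose X g f, Z))\<rparr>"

text \<open>
  The elements of a set in \<open>U\<close> have type \<open>'u\<close>, but functions on a set \<open>A\<close> of elements of
  type \<open>'a\<close> have type \<open>'a \<Rightarrow> 'u\<close>. Just as set theory codes a function as a set of pairs, a
  coding \<open>c\<close> turns a function \<open>\<phi>\<close> into an element \<open>c \<phi>\<close>, and the set \<open>X\<^sup>A\<close> consists of the codes
  of the functions \<open>A \<rightarrow> X\<close>.
\<close>

definition power :: "(('a \<Rightarrow> 'u) \<Rightarrow> 'u) \<Rightarrow> 'a set \<Rightarrow> 'u set \<Rightarrow> 'u set" where
  "power c A X = c ` (A \<rightarrow>\<^sub>E X)"

definition decode :: "(('a \<Rightarrow> 'u) \<Rightarrow> 'u) \<Rightarrow> 'a set \<Rightarrow> 'u set \<Rightarrow> 'u \<Rightarrow> 'a \<Rightarrow> 'u" where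
  "decode c A X = inv_into (A \<rightarrow>\<^sub>E X) c"

text \<open>
  The properties of the universe of sets relative to a set \<open>A\<close>: it has \<open>A\<close>, up to bijection, as
  a member, \<open>c\<close> is a faithful coding, and \<open>X\<^sup>A\<close> is a member whenever \<open>X\<close> is. No other closure
  property is imposed, so every larger universe (for instance a Grothendieck universe
  containing \<open>A\<close>) qualifies, and \<open>universe_exists\<close> below shows that suitable universes
  exist for any two sets, finite or infinite.
\<close>

definition universe_for :: "'u set set \<Rightarrow> (('a \<Rightarrow> 'u) \<Rightarrow> 'u) \<Rightarrow> 'a set \<Rightarrow> bool" where
  "universe_for U c A \<longleftrightarrow>
     (\<exists>X\<in>U. X \<approx> A) \<and> (\<forall>X\<in>U. inj_on c (A \<rightarrow>\<^sub>E X) \<and> power c A X \<in> U)"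

definition group_comonad ::
    "'u set set \<Rightarrow> (('g \<Rightarrow> 'u) \<Rightarrow> 'u) \<Rightarrow> ('g, 'm) monoid_scheme \<Rightarrow>
     ('u set, 'u set \<times> ('u \<Rightarrow> 'u) \<times> 'u set) comonad_data" where
  "group_comonad U c G =
     (let A = carrier G; P = power c A; d = decode c A in
      \<lparr>Fun =
         \<lparr>FObj = (\<lambda>X\<in>U. P X),
          FArr = restrict (\<lambda>(X, f, Y). (P X, (\<lambda>p\<in>P X. c (compose A f (d X p))), P Y))
                   (Arr (Sets U))\<rparr>,
       counit = (\<lambda>X\<in>U. (P X, (\<lambda>p\<in>P X. d X p \<one>\<^bsub>G\<^esub>), X)),
       comult =
         (\<lambda>X\<in>U. (P X, (\<lambda>p\<in>P X. c (\<lambda>g\<in>A. c (\<lambda>h\<in>A. d X p (g \<otimes>\<^bsub>G\<^esub> h)))), P (P X)))\<rparr>)"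


section \<open>Well-definedness\<close>

lemma category_Sets: "category (Sets U)"
  unfolding category_def Sets_def arrows_def
  by (auto simp: compose_def PiE_iff extensional_def fun_eq_iff)

lemma
  assumes "category C"
  shows category_arrow: "f \<in> arrows C X Y \<Longrightarrow> f \<in> Arr C \<and> X \<in> Obj C \<and> Y \<in> Obj C"
    and category_Id: "X \<in> Obj C \<Longrightarrow> Id C X \<in> arrows C X X"
    and category_Comp: "f \<in> arrows C X Y \<Longrightarrow> g \<in> arrows C Y Z \<Longrightarrow> Comp C g f \<in> arrows C X Z"
    and category_Id_right: "f \<in> arrows C X Y \<Longrightarrow> Comp C f (Id C X) = f"
    and category_Id_left: "f \<in> arrows C X Y \<Longrightarrow> Comp C (Id C Y) f = f"
    and category_assoc: "f \<in> arrows C X Y \<Longrightarrow> g \<in> arrows C Y Z \<Longrightarrow> h \<in> arrows C Z W \<Longrightarrow>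
          Comp C (Comp C h g) f = Comp C h (Comp C g f)"
  using assms unfolding category_def arrows_def by auto

lemma
  assumes "endofunctor C F"
  shows endofunctor_obj: "X \<in> Obj C \<Longrightarrow> FObj F X \<in> Obj C"
    and endofunctor_arr: "f \<in> arrows C X Y \<Longrightarrow> FArr F f \<in> arrows C (FObj F X) (FObj F Y)"
    and endofunctor_Id: "X \<in> Obj C \<Longrightarrow> FArr F (Id C X) = Id C (FObj F X)"
    and endofunctor_Comp: "f \<in> arrows C X Y \<Longrightarrow> g \<in> arrows C Y Z \<Longrightarrow>
          FArr F (Comp C g f) = Comp C (FArr F g) (FArr F f)"
  using assms unfolding endofunctor_def arrows_def by auto

lemma
  assumes "nat_trans C F T \<tau>"
  shows nat_trans_component: "X \<in> Obj C \<Longrightarrow> \<tau> X \<in> arrows C (FObj F X) (FObj T X)"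
    and nat_trans_natural: "f \<in> arrows C X Y \<Longrightarrow>
          Comp C (\<tau> Y) (FArr F f) = Comp C (FArr T f) (\<tau> X)"
    and nat_trans_extensional: "\<tau> \<in> extensional (Obj C)"
  using assms unfolding nat_trans_def arrows_def by auto

lemma nat_trans_vcomp:
  assumes C: "category C" and F: "endofunctor C F" "endofunctor C F'" "endofunctor C F''"
    and s: "nat_trans C F F' \<sigma>" and t: "nat_trans C F' F'' \<tau>"
  shows "nat_trans C F F'' (vcomp C \<tau> \<sigma>)"
  unfolding nat_trans_def
proof (intro conjI ballI)
  show "vcomp C \<tau> \<sigma> \<in> extensional (Obj C)" by (simp add: vcomp_def)
next
  fix X assume X: "X \<in> Obj C"
  then show "vcomp C \<tau> \<sigma> X \<in> arrows C (FObj F X) (FObj F'' X)"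
    using category_Comp[OF C nat_trans_component[OF s X] nat_trans_component[OF t X]]
    by (simp add: vcomp_def)
next
  fix f assume "f \<in> Arr C"
  then obtain X Y where f: "f \<in> arrows C X Y" and d: "Dom C f = X" "Cod C f = Y"
    by (simp add: arrows_def)
  have XY: "X \<in> Obj C" "Y \<in> Obj C" using category_arrow[OF C f] by auto
  note a = nat_trans_component[OF s XY(1)] nat_trans_component[OF s XY(2)]
    nat_trans_component[OF t XY(1)] nat_trans_component[OF t XY(2)]
    F[THEN endofunctor_arr, OF f]
  show "Comp C (vcomp C \<tau> \<sigma> (Cod C f)) (FArr F f) = Comp C (FArr F'' f) (vcomp C \<tau> \<sigma> (Dom C f))"
    unfolding d
    by (simp add: vcomp_def XY category_assoc[OF C a(5,2,4)] nat_trans_natural[OF s f]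
        category_assoc[OF C a(1,6,4), symmetric] nat_trans_natural[OF t f]
        category_assoc[OF C a(1,3,7)])
qed

lemma comonad_morphism_vcomp:
  assumes C: "category C" and K: "comonad C K" and K': "comonad C K'" and K'': "comonad C K''"
    and f: "comonad_morphism C K K' \<phi>" and g: "comonad_morphism C K' K'' \<psi>"
  shows "comonad_morphism C K K'' (vcomp C \<psi> \<phi>)"
proof -
  have F: "endofunctor C (Fun K)" "endofunctor C (Fun K')" "endofunctor C (Fun K'')"
    using K K' K'' by (auto simp: comonad_def)
  have nf: "nat_trans C (Fun K) (Fun K') \<phi>" and ng: "nat_trans C (Fun K') (Fun K'') \<psi>"
    using f g by (auto simp: comonad_morphism_def)
  have e: "X \<in> Obj C \<Longrightarrow> counit L X \<in> arrows C (FObj (Fun L) X) X"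
    if "comonad C L" for L X
    using that nat_trans_component[of C "Fun L" "id_endofun C" "counit L" X]
    by (auto simp: comonad_def id_endofun_def)
  have D: "X \<in> Obj C \<Longrightarrow> comult L X \<in> arrows C (FObj (Fun L) X) (FObj (Fun L) (FObj (Fun L) X))"
    if "comonad C L" for L X
    using that nat_trans_component[of C "Fun L" "comp_endofun C (Fun L) (Fun L)" "comult L" X]
    by (auto simp: comonad_def comp_endofun_def compose_def)
  have fe: "Comp C (counit K' X) (\<phi> X) = counit K X"
    and fD: "Comp C (comult K' X) (\<phi> X) =
      Comp C (Comp C (\<phi> (FObj (Fun K') X)) (FArr (Fun K) (\<phi> X))) (comult K X)"
    if "X \<in> Obj C" for X
    using f that unfolding comonad_morphism_def vcomp_def hcomp_def
    by (auto dest!: fun_cong[of _ _ X])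
  have ge: "Comp C (counit K'' X) (\<psi> X) = counit K' X"
    and gD: "Comp C (comult K'' X) (\<psi> X) =
      Comp C (Comp C (\<psi> (FObj (Fun K'') X)) (FArr (Fun K') (\<psi> X))) (comult K' X)"
    if "X \<in> Obj C" for X
    using g that unfolding comonad_morphism_def vcomp_def hcomp_def
    by (auto dest!: fun_cong[of _ _ X])
  show ?thesis
    unfolding comonad_morphism_def
  proof (intro conjI)
    show "nat_trans C (Fun K) (Fun K'') (vcomp C \<psi> \<phi>)"
      by (rule nat_trans_vcomp[OF C F nf ng])
  next
    have ext: "counit K \<in> extensional (Obj C)"
      using K by (auto simp: comonad_def nat_trans_def)
    show "vcomp C (counit K'') (vcomp C \<psi> \<phi>) = counit K"
    proof (rule extensionalityI[OF _ ext])
      fix X assume X: "X \<in> Obj C"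
      show "vcomp C (counit K'') (vcomp C \<psi> \<phi>) X = counit K X"
        using category_assoc[OF C nat_trans_component[OF nf X] nat_trans_component[OF ng X]
            e[OF K'' X]] X fe[OF X] ge[OF X]
        by (simp add: vcomp_def)
    qed (simp add: vcomp_def)
  next
    show "vcomp C (comult K'') (vcomp C \<psi> \<phi>) =
      vcomp C (hcomp C (Fun K) (Fun K'') (vcomp C \<psi> \<phi>) (vcomp C \<psi> \<phi>)) (comult K)"
    proof (rule extensionalityI)
      fix X assume X: "X \<in> Obj C"
      let ?c = "Comp C"
      let ?X1 = "FObj (Fun K') X" and ?X2 = "FObj (Fun K'') X"
      have X1: "?X1 \<in> Obj C" and X2: "?X2 \<in> Obj C"
        using F X by (auto intro: endofunctor_obj)
      note pX = nat_trans_component[OF nf X] and pX1 = nat_trans_component[OF nf X1]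
        and pX2 = nat_trans_component[OF nf X2]
      note qX = nat_trans_component[OF ng X] and qX2 = nat_trans_component[OF ng X2]
      note Kp = endofunctor_arr[OF F(1) pX] and Kq = endofunctor_arr[OF F(1) qX]
        and K'q = endofunctor_arr[OF F(2) qX]
      note DX = D[OF K X] and DX' = D[OF K' X] and DX'' = D[OF K'' X]
      have "?c (comult K'' X) (?c (\<psi> X) (\<phi> X)) = ?c (?c (comult K'' X) (\<psi> X)) (\<phi> X)"
        by (rule category_assoc[OF C pX qX DX'', symmetric])
      also have "\<dots> = ?c (?c (\<psi> ?X2) (FArr (Fun K') (\<psi> X))) (?c (comult K' X) (\<phi> X))"
        unfolding gD[OF X] by (rule category_assoc[OF C pX DX' category_Comp[OF C K'q qX2]])
      also have "\<dots> = ?c (?c (?c (\<psi> ?X2) (FArr (Fun K') (\<psi> X)))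
          (?c (\<phi> ?X1) (FArr (Fun K) (\<phi> X)))) (comult K X)"
        unfolding fD[OF X]
        by (rule category_assoc[OF C DX category_Comp[OF C Kp pX1] category_Comp[OF C K'q qX2],
              symmetric])
      also have "?c (?c (\<psi> ?X2) (FArr (Fun K') (\<psi> X))) (?c (\<phi> ?X1) (FArr (Fun K) (\<phi> X))) =
          ?c (\<psi> ?X2) (?c (?c (FArr (Fun K') (\<psi> X)) (\<phi> ?X1)) (FArr (Fun K) (\<phi> X)))"
        by (simp add: category_assoc[OF C category_Comp[OF C Kp pX1] K'q qX2]
            category_assoc[OF C Kp pX1 K'q])
      also have "?c (FArr (Fun K') (\<psi> X)) (\<phi> ?X1) = ?c (\<phi> ?X2) (FArr (Fun K) (\<psi> X))"
        by (rule nat_trans_natural[OF nf qX, symmetric])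
      also have "?c (\<psi> ?X2) (?c (?c (\<phi> ?X2) (FArr (Fun K) (\<psi> X))) (FArr (Fun K) (\<phi> X))) =
          ?c (?c (\<psi> ?X2) (\<phi> ?X2)) (FArr (Fun K) (?c (\<psi> X) (\<phi> X)))"
        by (simp add: category_assoc[OF C Kp Kq pX2] endofunctor_Comp[OF F(1) pX qX]
            category_assoc[OF C category_Comp[OF C Kp Kq] pX2 qX2])
      finally show "vcomp C (comult K'') (vcomp C \<psi> \<phi>) X =
        vcomp C (hcomp C (Fun K) (Fun K'') (vcomp C \<psi> \<phi>) (vcomp C \<psi> \<phi>)) (comult K) X"
        using X X2 by (simp add: vcomp_def hcomp_def)
    qed (simp_all add: vcomp_def)
  qed
qed

lemma comonad_morphism_Id:
  assumes C: "category C" and K: "comonad C K"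
  shows "comonad_morphism C K K (\<lambda>X\<in>Obj C. Id C (FObj (Fun K) X))"
proof -
  have F: "endofunctor C (Fun K)" using K by (auto simp: comonad_def)
  have e: "X \<in> Obj C \<Longrightarrow> counit K X \<in> arrows C (FObj (Fun K) X) X" for X
    using K nat_trans_component[of C "Fun K" "id_endofun C" "counit K" X]
    by (auto simp: comonad_def id_endofun_def)
  have D: "X \<in> Obj C \<Longrightarrow> comult K X \<in> arrows C (FObj (Fun K) X) (FObj (Fun K) (FObj (Fun K) X))"
    for X
    using K nat_trans_component[of C "Fun K" "comp_endofun C (Fun K) (Fun K)" "comult K" X]
    by (auto simp: comonad_def comp_endofun_def compose_def)
  have ext: "counit K \<in> extensional (Obj C)"
    using K by (auto simp: comonad_def nat_trans_def)
  note obj = endofunctor_obj[OF F]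
  show ?thesis
    unfolding comonad_morphism_def
  proof (intro conjI)
    show "nat_trans C (Fun K) (Fun K) (\<lambda>X\<in>Obj C. Id C (FObj (Fun K) X))"
      unfolding nat_trans_def
    proof (intro conjI ballI)
      fix f assume "f \<in> Arr C"
      then have f: "f \<in> arrows C (Dom C f) (Cod C f)" by (simp add: arrows_def)
      show "Comp C ((\<lambda>X\<in>Obj C. Id C (FObj (Fun K) X)) (Cod C f)) (FArr (Fun K) f) =
          Comp C (FArr (Fun K) f) ((\<lambda>X\<in>Obj C. Id C (FObj (Fun K) X)) (Dom C f))"
        using category_arrow[OF C f] endofunctor_arr[OF F f]
        by (simp add: category_Id_left[OF C] category_Id_right[OF C])
    qed (auto intro: category_Id[OF C] obj)
    show "vcomp C (counit K) (\<lambda>X\<in>Obj C. Id C (FObj (Fun K) X)) = counit K"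
      by (rule extensionalityI[OF _ ext]) (auto simp: vcomp_def category_Id_right[OF C e])
    show "vcomp C (comult K) (\<lambda>X\<in>Obj C. Id C (FObj (Fun K) X)) =
      vcomp C (hcomp C (Fun K) (Fun K) (\<lambda>X\<in>Obj C. Id C (FObj (Fun K) X))
        (\<lambda>X\<in>Obj C. Id C (FObj (Fun K) X))) (comult K)"
      by (rule extensionalityI[where A = "Obj C"])
        (auto simp: vcomp_def hcomp_def obj endofunctor_Id[OF F] category_Id_right[OF C D]
          category_Id_left[OF C category_Id[OF C]] category_Id_left[OF C D])
  qed
qed

lemma category_Comonads:
  assumes C: "category C"
  shows "category (Comonads C)"
proof -
  have F: "endofunctor C (Fun K)" if "comonad C K" for K
    using that by (auto simp: comonad_def)
  have comp: "\<phi> X \<in> arrows C (FObj (Fun K) X) (FObj (Fun K') X)"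
    if "comonad_morphism C K K' \<phi>" "X \<in> Obj C" for K K' \<phi> X
    using that nat_trans_component by (auto simp: comonad_morphism_def)
  have ext: "\<phi> \<in> extensional (Obj C)" if "comonad_morphism C K K' \<phi>" for K K' \<phi>
    using that nat_trans_extensional by (auto simp: comonad_morphism_def)
  have r: "vcomp C \<phi> (\<lambda>X\<in>Obj C. Id C (FObj (Fun K) X)) = \<phi>"
    and l: "vcomp C (\<lambda>X\<in>Obj C. Id C (FObj (Fun K') X)) \<phi> = \<phi>"
    if "comonad_morphism C K K' \<phi>" for K K' \<phi>
    by (rule extensionalityI[OF _ ext[OF that]];
        simp add: vcomp_def category_Id_right[OF C comp[OF that]]
          category_Id_left[OF C comp[OF that]])+
  have a: "vcomp C \<chi> (vcomp C \<psi> \<phi>) = vcomp C (vcomp C \<chi> \<psi>) \<phi>"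
    if m: "comonad_morphism C K K' \<phi>" "comonad_morphism C K' K'' \<psi>"
      "comonad_morphism C K'' L \<chi>" for K K' K'' L \<phi> \<psi> \<chi>
    by (rule extensionalityI[where A = "Obj C"])
      (simp_all add: vcomp_def category_assoc[OF C comp[OF m(1)] comp[OF m(2)] comp[OF m(3)]])
  show ?thesis
    unfolding category_def arrows_def Comonads_def
    by (auto simp: r l comonad_morphism_Id[OF C] intro: comonad_morphism_vcomp[OF C] a)
qed

lemma
  assumes "universe_for U c A" and "X \<in> U"
  shows decode_code: "\<phi> \<in> A \<rightarrow>\<^sub>E X \<Longrightarrow> decode c A X (c \<phi>) = \<phi>"
    and power_in: "power c A X \<in> U"
  using assms by (auto simp: universe_for_def decode_def)

lemma code_in_power: "\<phi> \<in> A \<rightarrow>\<^sub>E X \<Longrightarrow> c \<phi> \<in> power c A X"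
  by (simp add: power_def)

lemma power_ext:
  assumes "f \<in> extensional (power c A X)" "g \<in> extensional (power c A X)"
    and "\<And>\<phi>. \<phi> \<in> A \<rightarrow>\<^sub>E X \<Longrightarrow> f (c \<phi>) = g (c \<phi>)"
  shows "f = g"
  using assms by (auto intro!: extensionalityI[of f "power c A X" g] simp: power_def)

lemma power_PiE:
  assumes "f \<in> extensional (power c A X)"
    and "\<And>\<phi>. \<phi> \<in> A \<rightarrow>\<^sub>E X \<Longrightarrow> f (c \<phi>) \<in> Y"
  shows "f \<in> power c A X \<rightarrow>\<^sub>E Y"
  using assms by (auto simp: power_def PiE_iff)

lemma comonad_group_comonad:
  assumes G: "group G" and U: "universe_for U c (carrier G)"
  shows "comonad (Sets U) (group_comonad U c G)"
proof -
  interpret group G by (rule G)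
  let ?A = "carrier G" and ?S = "Sets U" and ?K = "group_comonad U c G"
  define P where "P = power c ?A"
  define e where "e X = (\<lambda>p\<in>P X. decode c ?A X p \<one>\<^bsub>G\<^esub>)" for X
  define D where
    "D X = (\<lambda>p\<in>P X. c (\<lambda>g\<in>?A. c (\<lambda>h\<in>?A. decode c ?A X p (g \<otimes>\<^bsub>G\<^esub> h))))" for X
  define m where "m X f = (\<lambda>p\<in>P X. c (compose ?A f (decode c ?A X p)))" for X f
  have PU: "X \<in> U \<Longrightarrow> P X \<in> U" for X using power_in[OF U] by (simp add: P_def)
  have cP: "\<phi> \<in> ?A \<rightarrow>\<^sub>E X \<Longrightarrow> c \<phi> \<in> P X" for \<phi> X
    by (simp add: P_def code_in_power)
  have ext: "e X \<in> extensional (P X)" "D X \<in> extensional (P X)" "m X f \<in> extensional (P X)" for X f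
    by (auto simp: e_def D_def m_def)
  have ev: "X \<in> U \<Longrightarrow> \<phi> \<in> ?A \<rightarrow>\<^sub>E X \<Longrightarrow> e X (c \<phi>) = \<phi> \<one>\<^bsub>G\<^esub>" for X \<phi>
    by (simp add: e_def cP decode_code[OF U])
  have Dv: "X \<in> U \<Longrightarrow> \<phi> \<in> ?A \<rightarrow>\<^sub>E X \<Longrightarrow> D X (c \<phi>) = c (\<lambda>g\<in>?A. c (\<lambda>h\<in>?A. \<phi> (g \<otimes>\<^bsub>G\<^esub> h)))" for X \<phi>
    by (simp add: D_def cP decode_code[OF U])
  have mv: "X \<in> U \<Longrightarrow> \<phi> \<in> ?A \<rightarrow>\<^sub>E X \<Longrightarrow> m X f (c \<phi>) = c (compose ?A f \<phi>)" for X f \<phi>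
    by (simp add: m_def cP decode_code[OF U])
  have shift: "(\<lambda>h\<in>?A. \<phi> (g \<otimes>\<^bsub>G\<^esub> h)) \<in> ?A \<rightarrow>\<^sub>E X" if "\<phi> \<in> ?A \<rightarrow>\<^sub>E X" "g \<in> ?A" for \<phi> g X
    using that by auto
  have shifts: "(\<lambda>g\<in>?A. c (\<lambda>h\<in>?A. \<phi> (g \<otimes>\<^bsub>G\<^esub> h))) \<in> ?A \<rightarrow>\<^sub>E P X" if "\<phi> \<in> ?A \<rightarrow>\<^sub>E X" for \<phi> X
    using that by (intro restrict_PiE_iff[THEN iffD2] ballI cP shift)
  have compA: "compose ?A f \<phi> \<in> ?A \<rightarrow>\<^sub>E Y" if "\<phi> \<in> ?A \<rightarrow>\<^sub>E X" "f \<in> X \<rightarrow>\<^sub>E Y" for \<phi> f X Y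
    using that by (auto simp: compose_def PiE_iff)
  have PiEI: "f \<in> P X \<rightarrow>\<^sub>E Y" if "f \<in> extensional (P X)"
    "\<And>\<phi>. \<phi> \<in> ?A \<rightarrow>\<^sub>E X \<Longrightarrow> f (c \<phi>) \<in> Y" for f X Y
    using that unfolding P_def by (rule power_PiE)
  have eP: "e X \<in> P X \<rightarrow>\<^sub>E X" if "X \<in> U" for X
    by (rule PiEI[OF ext(1)]) (use that in \<open>auto simp: ev\<close>)
  have DP: "D X \<in> P X \<rightarrow>\<^sub>E P (P X)" if "X \<in> U" for X
    by (rule PiEI[OF ext(2)]) (simp only: Dv that cP shifts)
  have mP: "m X f \<in> P X \<rightarrow>\<^sub>E P Y" if "X \<in> U" "f \<in> X \<rightarrow>\<^sub>E Y" for X Y f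
    by (rule PiEI[OF ext(3)]) (use that in \<open>simp add: mv cP compA\<close>)
  have extI: "f = g" if "f \<in> extensional (P X)" "g \<in> extensional (P X)"
    "\<And>\<phi>. \<phi> \<in> ?A \<rightarrow>\<^sub>E X \<Longrightarrow> f (c \<phi>) = g (c \<phi>)" for f g X
    using that unfolding P_def by (rule power_ext)
  have id_comp: "compose ?A (\<lambda>x\<in>X. x) \<phi> = \<phi>"
    and comp_comp: "compose ?A (compose X g f) \<phi> = compose ?A g (compose ?A f \<phi>)"
    if "\<phi> \<in> ?A \<rightarrow>\<^sub>E X" for \<phi> X and f g :: "'u \<Rightarrow> 'u"
    using that by (auto simp: compose_def PiE_iff extensional_def fun_eq_iff)
  have comp_restrict: "compose ?A f (restrict \<phi> ?A) = (\<lambda>g\<in>?A. f (\<phi> g))"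
    for f :: "'u \<Rightarrow> 'u" and \<phi>
    by (auto simp: compose_def)

  have m_id: "m X (\<lambda>x\<in>X. x) = (\<lambda>p\<in>P X. p)" if "X \<in> U" for X
    by (rule extI[of _ X]) (use that ext in \<open>auto simp: mv cP id_comp\<close>)
  have m_comp: "m X (compose X g f) = compose (P X) (m Y g) (m X f)"
    if "X \<in> U" "Y \<in> U" "f \<in> X \<rightarrow>\<^sub>E Y" for X Y f g
    by (rule extI[of _ X])
      (use that ext in \<open>auto simp: mv cP compA compose_eq comp_comp\<close>)
  have e_nat: "compose (P X) (e Y) (m X f) = compose (P X) f (e X)"
    if "X \<in> U" "Y \<in> U" "f \<in> X \<rightarrow>\<^sub>E Y" for X Y f
    by (rule extI[of _ X])
      (use that in \<open>auto simp: mv ev cP compA compose_eq\<close>)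
  have D_nat: "compose (P X) (D Y) (m X f) = compose (P X) (m (P X) (m X f)) (D X)"
    if "X \<in> U" "Y \<in> U" "f \<in> X \<rightarrow>\<^sub>E Y" for X Y f
  proof (rule extI[of _ X])
    fix \<phi> assume p: "\<phi> \<in> ?A \<rightarrow>\<^sub>E X"
    have "(\<lambda>g\<in>?A. c (\<lambda>h\<in>?A. compose ?A f \<phi> (g \<otimes>\<^bsub>G\<^esub> h))) =
        compose ?A (m X f) (\<lambda>g\<in>?A. c (\<lambda>h\<in>?A. \<phi> (g \<otimes>\<^bsub>G\<^esub> h)))"
      using that(1) shift[OF p] by (simp add: comp_restrict mv compose_eq cong: restrict_cong)
    then show "compose (P X) (D Y) (m X f) (c \<phi>) = compose (P X) (m (P X) (m X f)) (D X) (c \<phi>)"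
      using that p
      by (simp add: compose_eq cP mv Dv compA[OF p that(3)] mv[OF PU[OF that(1)] shifts[OF p]])
  qed auto
  have eD: "compose (P X) (e (P X)) (D X) = (\<lambda>p\<in>P X. p)" if "X \<in> U" for X
  proof (rule extI[of _ X])
    fix \<phi> assume p: "\<phi> \<in> ?A \<rightarrow>\<^sub>E X"
    have "(\<lambda>h\<in>?A. \<phi> (\<one>\<^bsub>G\<^esub> \<otimes>\<^bsub>G\<^esub> h)) = \<phi>"
      using p by (auto simp: fun_eq_iff PiE_iff extensional_def)
    then show "compose (P X) (e (P X)) (D X) (c \<phi>) = (\<lambda>p\<in>P X. p) (c \<phi>)"
      using p that by (simp add: Dv cP compose_eq ev[OF PU[OF that] shifts[OF p]])
  qed auto
  have meD: "compose (P X) (m (P X) (e X)) (D X) = (\<lambda>p\<in>P X. p)" if "X \<in> U" for X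
  proof (rule extI[of _ X])
    fix \<phi> assume p: "\<phi> \<in> ?A \<rightarrow>\<^sub>E X"
    have "compose ?A (e X) (\<lambda>g\<in>?A. c (\<lambda>h\<in>?A. \<phi> (g \<otimes>\<^bsub>G\<^esub> h))) = \<phi>"
      using p that
      by (intro extensionalityI[where A = ?A]) (auto simp: PiE_iff compose_eq ev shift)
    then show "compose (P X) (m (P X) (e X)) (D X) (c \<phi>) = (\<lambda>p\<in>P X. p) (c \<phi>)"
      using p that by (simp add: Dv cP compose_eq mv[OF PU[OF that] shifts[OF p]])
  qed auto
  have DD: "compose (P X) (D (P X)) (D X) = compose (P X) (m (P X) (D X)) (D X)" if "X \<in> U" for X
  proof (rule extI[of _ X])
    fix \<phi> assume p: "\<phi> \<in> ?A \<rightarrow>\<^sub>E X"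
    have "(\<lambda>g\<in>?A. c (\<lambda>k\<in>?A. (\<lambda>g\<in>?A. c (\<lambda>h\<in>?A. \<phi> (g \<otimes>\<^bsub>G\<^esub> h))) (g \<otimes>\<^bsub>G\<^esub> k))) =
        compose ?A (D X) (\<lambda>g\<in>?A. c (\<lambda>h\<in>?A. \<phi> (g \<otimes>\<^bsub>G\<^esub> h)))"
      using that(1) shift[OF p] by (simp add: comp_restrict Dv m_assoc cong: restrict_cong)
    then show "compose (P X) (D (P X)) (D X) (c \<phi>) = compose (P X) (m (P X) (D X)) (D X) (c \<phi>)"
      using that p
      by (simp add: compose_eq cP Dv mv[OF PU[OF that] shifts[OF p]] Dv[OF PU[OF that] shifts[OF p]])
  qed auto

  have FObj: "FObj (Fun ?K) = (\<lambda>X\<in>U. P X)"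
    by (simp add: group_comonad_def Let_def P_def)
  have FArr: "FArr (Fun ?K) (X, f, Y) = (P X, m X f, P Y)"
    if "X \<in> U" "Y \<in> U" "f \<in> X \<rightarrow>\<^sub>E Y" for X Y f
    using that by (simp add: group_comonad_def Let_def P_def m_def Sets_def)
  have FArr_ext: "FArr (Fun ?K) \<in> extensional (Arr ?S)"
    by (simp add: group_comonad_def Let_def)
  have counit: "counit ?K = (\<lambda>X\<in>U. (P X, e X, X))"
    and comult: "comult ?K = (\<lambda>X\<in>U. (P X, D X, P (P X)))"
    by (simp_all add: group_comonad_def Let_def P_def e_def D_def)
  have Sets: "Obj ?S = U" "Dom ?S (X, f, Y) = X" "Cod ?S (X, f, Y) = Y"
    "Id ?S X = (X, \<lambda>x\<in>X. x, X)" "Comp ?S (Y, g, Z) (X, f, Y') = (X, compose X g f, Z)"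
    "(X, f, Y) \<in> Arr ?S \<longleftrightarrow> X \<in> U \<and> Y \<in> U \<and> f \<in> X \<rightarrow>\<^sub>E Y" for X f Y g Z Y'
    by (auto simp: Sets_def)
  have comp_PiE: "compose X g f \<in> X \<rightarrow>\<^sub>E Z" if "f \<in> X \<rightarrow>\<^sub>E Y" "g \<in> Y \<rightarrow>\<^sub>E Z"
    for X Y Z :: "'u set" and f g :: "'u \<Rightarrow> 'u"
    using that by (auto simp: compose_def PiE_iff)
  have id_PiE: "(\<lambda>x\<in>X. x) \<in> X \<rightarrow>\<^sub>E X" for X :: "'u set" by auto
  show ?thesis
    unfolding comonad_def
  proof (intro conjI)
    show "endofunctor ?S (Fun ?K)"
      unfolding endofunctor_def arrows_def
      by (intro conjI) (auto simp: FArr_ext FObj FArr Sets PU m_id id_PiE comp_PiE m_comp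
          simp del: restrict_apply intro!: mP intro: restrict_PiE_iff[THEN iffD2]
          | simp add: PU)+
  qed (use eP DP in \<open>auto simp: nat_trans_def arrows_def id_endofun_def comp_endofun_def FObj
      FArr counit comult Sets PU e_nat D_nat mP eD meD DD compose_eq compose_extensional\<close>)
qed


text \<open>
  For every pair of sets \<open>A\<close>, \<open>B\<close> and every type \<open>'a\<close> of atoms there is a universe: the type freely
  generated by the atoms and by codes for functions.
\<close>

datatype ('a, 'g, 'h) hered =
  Atom 'a | Code1 "'g \<Rightarrow> ('a, 'g, 'h) hered" | Code2 "'h \<Rightarrow> ('a, 'g, 'h) hered"

lemma universe_exists:
  fixes A :: "'g set" and B :: "'h set"
  shows "universe_for (UNIV :: ('a, 'g, 'h) hered set set) Code1 A"
    and "universe_for (UNIV :: ('a, 'g, 'h) hered set set) Code2 B"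
proof -
  fix a :: 'a
  define t where "t = (Atom a :: ('a, 'g, 'h) hered)"
  define i where "i x = Code1 (\<lambda>y. if y = x then t else Code1 (\<lambda>_. t))" for x :: 'g
  define j where "j x = Code2 (\<lambda>y. if y = x then t else Code1 (\<lambda>_. t))" for x :: 'h
  have "inj i" "inj j"
    unfolding i_def j_def t_def inj_def
    by (auto simp: fun_eq_iff)
  then have "i ` A \<approx> A" "j ` B \<approx> B"
    by (meson inj_on_image_eqpoll_self inj_on_subset subset_UNIV)+
  then show "universe_for (UNIV :: ('a, 'g, 'h) hered set set) Code1 A"
    and "universe_for (UNIV :: ('a, 'g, 'h) hered set set) Code2 B"
    unfolding universe_for_def by (auto intro!: inj_onI)
qed

end

theory Submission
  imports Defs
begin

text \<open>
  The functor \<open>X \<mapsto> X\<^sup>G\<close> is represented by \<open>G\<close>, so by the Yoneda lemma a natural transformation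
  \<open>X\<^sup>G \<rightarrow> X\<^sup>H\<close> is precomposition with a map \<open>u : H \<rightarrow> G\<close>. Compatibility with the
  comultiplications, tested on an injective function on \<open>G\<close>, says that \<open>u\<close> is multiplicative.
  Mutually inverse comonad morphisms therefore give mutually inverse homomorphisms.
\<close>

lemma compose_PiE: "f \<in> A \<rightarrow>\<^sub>E B \<Longrightarrow> g \<in> B \<rightarrow>\<^sub>E C \<Longrightarrow> compose A g f \<in> A \<rightarrow>\<^sub>E C"
  by (auto simp: compose_def PiE_iff)

lemma Sets_simps:
  "Obj (Sets U) = U"
  "Id (Sets U) X = (X, \<lambda>x\<in>X. x, X)"
  "Comp (Sets U) (Y, g, Z) (X, f, Y') = (X, compose X g f, Z)"
  by (auto simp: Sets_def)

lemma arrows_SetsD: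
  assumes "a \<in> arrows (Sets U) X Y"
  shows "a = (X, fst (snd a), Y)" "fst (snd a) \<in> X \<rightarrow>\<^sub>E Y"
  using assms by (auto simp: arrows_def Sets_def)

lemma arrows_SetsI: "X \<in> U \<Longrightarrow> Y \<in> U \<Longrightarrow> f \<in> X \<rightarrow>\<^sub>E Y \<Longrightarrow> (X, f, Y) \<in> arrows (Sets U) X Y"
  by (auto simp: arrows_def Sets_def)

lemma FObj_group_comonad:
  "X \<in> U \<Longrightarrow> FObj (Fun (group_comonad U c G)) X = power c (carrier G) X"
  by (simp add: group_comonad_def Let_def)

lemma FArr_group_comonad:
  "X \<in> U \<Longrightarrow> Y \<in> U \<Longrightarrow> f \<in> X \<rightarrow>\<^sub>E Y \<Longrightarrow>
    FArr (Fun (group_comonad U c G)) (X, f, Y) =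
      (power c (carrier G) X,
       (\<lambda>p\<in>power c (carrier G) X. c (compose (carrier G) f (decode c (carrier G) X p))),
       power c (carrier G) Y)"
  by (simp add: group_comonad_def Let_def Sets_def)

lemma comult_group_comonad:
  "X \<in> U \<Longrightarrow> comult (group_comonad U c G) X =
    (power c (carrier G) X,
     (\<lambda>p\<in>power c (carrier G) X.
       c (\<lambda>g\<in>carrier G. c (\<lambda>h\<in>carrier G. decode c (carrier G) X p (g \<otimes>\<^bsub>G\<^esub> h)))),
     power c (carrier G) (power c (carrier G) X))"
  by (simp add: group_comonad_def Let_def)

text \<open>The sets in \<open>U\<close> have elements of type \<open>'u\<close>, so a carrier
  enters \<open>U\<close> only as a bijective copy \<open>X\<close>. The bijection \<open>b\<close>
  stands in for the identity map, the universal element of a representable functor. It is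
  extensional so that \<open>c b\<close> lies in \<open>power c A X\<close>.\<close>

lemma universe_for_bij:
  assumes "universe_for U c A"
  obtains X b where "X \<in> U" "bij_betw b A X" "b \<in> A \<rightarrow>\<^sub>E X"
proof -
  obtain X where X: "X \<in> U" "A \<approx> X"
    using assms eqpoll_sym unfolding universe_for_def by blast
  then obtain b where b: "bij_betw b A X" by (auto simp: eqpoll_def)
  have "bij_betw (restrict b A) A X"
    using b by (simp cong: bij_betw_cong)
  moreover have "restrict b A \<in> A \<rightarrow>\<^sub>E X"
    using bij_betwE[OF b] by auto
  ultimately show ?thesis using that X(1) by blast
qed

text \<open>Composition in \<open>Sets U\<close> matches on triples, so components must appear as
  explicit triples; \<open>fst (snd (\<phi> X))\<close> is the underlying function of
  \<open>\<phi> X\<close>.\<close>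

lemma nat_trans_group_comonad_component:
  assumes "nat_trans (Sets U) (Fun (group_comonad U c G)) (Fun (group_comonad U d H)) \<phi>"
    and "X \<in> U"
  shows "\<phi> X = (power c (carrier G) X, fst (snd (\<phi> X)), power d (carrier H) X)"
    and "fst (snd (\<phi> X)) \<in> power c (carrier G) X \<rightarrow>\<^sub>E power d (carrier H) X"
  using arrows_SetsD[OF nat_trans_component[OF assms(1), of X]] assms(2)
  by (simp_all add: Sets_simps FObj_group_comonad)

text \<open>Every \<open>f\<close> factors through the bijection \<open>b\<close> onto a copy of the
  carrier of \<open>G\<close> in \<open>U\<close>, so naturality determines the value of
  \<open>\<phi>\<close> at \<open>c f\<close> from its value at \<open>c b\<close>.\<close>

lemma nat_trans_group_comonad_Yoneda:
  assumes U: "universe_for U c (carrier G)" "universe_for U d (carrier H)"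
    and nat: "nat_trans (Sets U) (Fun (group_comonad U c G)) (Fun (group_comonad U d H)) \<phi>"
  obtains u where "u \<in> carrier H \<rightarrow> carrier G"
    and "\<And>X f. X \<in> U \<Longrightarrow> f \<in> carrier G \<rightarrow>\<^sub>E X \<Longrightarrow>
      fst (snd (\<phi> X)) (c f) = d (compose (carrier H) f u)"
proof -
  let ?A = "carrier G" and ?B = "carrier H"
  obtain R b where R: "R \<in> U" and bij: "bij_betw b ?A R" and b: "b \<in> ?A \<rightarrow>\<^sub>E R"
    by (rule universe_for_bij[OF U(1)])
  define i where "i = inv_into ?A b"
  have ib: "i (b x) = x" if "x \<in> ?A" for x
    using that bij_betw_inv_into_left[OF bij] by (simp add: i_def)
  have i: "i y \<in> ?A" if "y \<in> R" for y
    using bij_betwE[OF bij_betw_inv_into[OF bij]] that by (auto simp: i_def)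
  \<comment> \<open>The value at the universal element is decoded to \<open>w\<close>; pulling
    \<open>w\<close> back along \<open>b\<close> gives the map \<open>u\<close>.\<close>
  have "fst (snd (\<phi> R)) (c b) \<in> power d ?B R"
    using nat_trans_group_comonad_component(2)[OF nat R] code_in_power[OF b, of c] by auto
  then obtain w where w: "w \<in> ?B \<rightarrow>\<^sub>E R" "fst (snd (\<phi> R)) (c b) = d w"
    by (auto simp: power_def)
  show ?thesis
  proof (rule that)
    show "compose ?B i w \<in> ?B \<rightarrow> ?A"
      using i PiE_mem[OF w(1)] by (simp add: compose_eq)
  next
    fix X f assume X: "X \<in> U" and f: "f \<in> ?A \<rightarrow>\<^sub>E X"
    \<comment> \<open>The factor \<open>g\<close> with \<open>g\<close> after \<open>b\<close> equal
      to \<open>f\<close> is an arrow of \<open>Sets U\<close>, which \<open>f\<close> itself is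
      not.\<close>
    define g where "g = compose R f i"
    have g: "g \<in> R \<rightarrow>\<^sub>E X"
      using f i by (auto simp: g_def compose_def)
    have gb: "compose ?A g b = f"
      using f b ib by (intro extensionalityI[where A = ?A]) (auto simp: PiE_iff g_def compose_eq)
    have gw: "compose ?B g w = compose ?B f (compose ?B i w)"
      using PiE_mem[OF w(1)] by (intro extensionalityI[where A = ?B]) (auto simp: g_def compose_eq)
    note \<phi>R = nat_trans_group_comonad_component[OF nat R]
    note \<phi>X = nat_trans_group_comonad_component[OF nat X]
    \<comment> \<open>This is the naturality square of \<open>g\<close>. At \<open>c b\<close> one
      path gives \<open>\<phi>\<close> at \<open>c f\<close>, the other the code of \<open>g\<close>
      after \<open>w\<close>.\<close>
    have "Comp (Sets U) (power c ?A X, fst (snd (\<phi> X)), power d ?B X)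
            (FArr (Fun (group_comonad U c G)) (R, g, X)) =
          Comp (Sets U) (FArr (Fun (group_comonad U d H)) (R, g, X))
            (power c ?A R, fst (snd (\<phi> R)), power d ?B R)"
      using nat_trans_natural[OF nat arrows_SetsI[OF R X g]] \<phi>R \<phi>X(1) by simp
    then have "compose (power c ?A R) (fst (snd (\<phi> X)))
          (\<lambda>p\<in>power c ?A R. c (compose ?A g (decode c ?A R p))) (c b) =
        compose (power c ?A R) (\<lambda>p\<in>power d ?B R. d (compose ?B g (decode d ?B R p)))
          (fst (snd (\<phi> R))) (c b)"
      by (simp add: FArr_group_comonad R X g Sets_simps)
    then show "fst (snd (\<phi> X)) (c f) = d (compose ?B f (compose ?B i w))"
      by (simp add: compose_eq code_in_power b w decode_code[OF U(1) R]
          decode_code[OF U(2) R] gb gw)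
  qed
qed

lemma comonad_morphism_group_comonad:
  assumes G: "group G" and H: "group H"
    and U: "universe_for U c (carrier G)" "universe_for U d (carrier H)"
    and mor: "comonad_morphism (Sets U) (group_comonad U c G) (group_comonad U d H) \<phi>"
  obtains u where "u \<in> hom H G"
    and "\<And>X f. X \<in> U \<Longrightarrow> f \<in> carrier G \<rightarrow>\<^sub>E X \<Longrightarrow>
      fst (snd (\<phi> X)) (c f) = d (compose (carrier H) f u)"
proof -
  interpret G: group G by (rule G)
  interpret H: group H by (rule H)
  let ?A = "carrier G" and ?B = "carrier H"
  let ?P = "power c ?A" and ?Q = "power d ?B"
  let ?t = "\<lambda>X. fst (snd (\<phi> X))"
  let ?S = "Sets U" and ?K = "group_comonad U c G" and ?L = "group_comonad U d H"
  have nat: "nat_trans ?S (Fun ?K) (Fun ?L) \<phi>"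
    using mor by (simp add: comonad_morphism_def)
  obtain u where u: "u \<in> ?B \<rightarrow> ?A"
    and t: "\<And>X f. X \<in> U \<Longrightarrow> f \<in> ?A \<rightarrow>\<^sub>E X \<Longrightarrow> ?t X (c f) = d (compose ?B f u)"
    by (rule nat_trans_group_comonad_Yoneda[OF U nat]) blast
  obtain X b where X: "X \<in> U" and bij: "bij_betw b ?A X" and b: "b \<in> ?A \<rightarrow>\<^sub>E X"
    by (rule universe_for_bij[OF U(1)])
  have inj: "inj_on b ?A"
    using bij by (rule bij_betw_imp_inj_on)
  have PX: "?P X \<in> U" and QX: "?Q X \<in> U"
    using power_in[OF U(1) X] power_in[OF U(2) X] by auto
  have tX: "?t X \<in> ?P X \<rightarrow>\<^sub>E ?Q X"
    by (rule nat_trans_group_comonad_component(2)[OF nat X])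
  \<comment> \<open>The horizontal composite at \<open>X\<close> is \<open>\<phi>\<close> at
    \<open>?Q X\<close> after the functor of \<open>G\<close> applied to \<open>\<phi> X\<close>, so
    both components are needed.\<close>
  have \<phi>X: "\<phi> X = (?P X, ?t X, ?Q X)" and \<phi>QX: "\<phi> (?Q X) = (?P (?Q X), ?t (?Q X), ?Q (?Q X))"
    using nat_trans_group_comonad_component(1)[OF nat] X QX by auto
  have bu: "compose ?B b u \<in> ?B \<rightarrow>\<^sub>E X"
    using u b by (auto simp: compose_def)
  have shift: "(\<lambda>h\<in>?A. b (g \<otimes>\<^bsub>G\<^esub> h)) \<in> ?A \<rightarrow>\<^sub>E X" if "g \<in> ?A" for g
    using that b by auto
  have shifts: "(\<lambda>g\<in>?A. c (\<lambda>h\<in>?A. b (g \<otimes>\<^bsub>G\<^esub> h))) \<in> ?A \<rightarrow>\<^sub>E ?P X"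
    by (intro restrict_PiE_iff[THEN iffD2] ballI code_in_power shift)
  let ?l = "\<lambda>h\<in>?B. d (\<lambda>k\<in>?B. b (u (h \<otimes>\<^bsub>H\<^esub> k)))"
  let ?r = "\<lambda>h\<in>?B. d (\<lambda>k\<in>?B. b (u h \<otimes>\<^bsub>G\<^esub> u k))"
  have l: "?l \<in> ?B \<rightarrow>\<^sub>E ?Q X" and r: "?r \<in> ?B \<rightarrow>\<^sub>E ?Q X"
    using u b by (intro restrict_PiE_iff[THEN iffD2] ballI code_in_power; fastforce)+
  have "vcomp ?S (comult ?L) \<phi> X = vcomp ?S (hcomp ?S (Fun ?K) (Fun ?L) \<phi> \<phi>) (comult ?K) X"
    using mor by (simp add: comonad_morphism_def)
  then have "Comp ?S (comult ?L X) (?P X, ?t X, ?Q X) =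
      Comp ?S (Comp ?S (?P (?Q X), ?t (?Q X), ?Q (?Q X)) (FArr (Fun ?K) (?P X, ?t X, ?Q X)))
        (comult ?K X)"
    \<comment> \<open>The right-hand side of \<open>\<phi>X\<close> contains \<open>\<phi> X\<close>
      itself, so these equations are used from right to left, folding the triples.\<close>
    by (simp add: vcomp_def hcomp_def Sets_simps X FObj_group_comonad flip: \<phi>X \<phi>QX)
  then have "compose (?P X)
        (\<lambda>p\<in>?Q X. d (\<lambda>g\<in>?B. d (\<lambda>h\<in>?B. decode d ?B X p (g \<otimes>\<^bsub>H\<^esub> h)))) (?t X) (c b) =
      compose (?P X)
        (compose (?P (?P X)) (?t (?Q X))
          (\<lambda>p\<in>?P (?P X). c (compose ?A (?t X) (decode c ?A (?P X) p))))
        (\<lambda>p\<in>?P X. c (\<lambda>g\<in>?A. c (\<lambda>h\<in>?A. decode c ?A X p (g \<otimes>\<^bsub>G\<^esub> h)))) (c b)"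
    by (simp add: comult_group_comonad X Sets_simps FArr_group_comonad PX QX tX)
  \<comment> \<open>The inner copy of \<open>\<phi>\<close> precomposes each left translate of
    \<open>b\<close> with \<open>u\<close>, producing \<open>u k\<close>; the outer copy then
    replaces the first argument by \<open>u h\<close>.\<close>
  moreover have "compose ?B (compose ?A (?t X) (\<lambda>g\<in>?A. c (\<lambda>h\<in>?A. b (g \<otimes>\<^bsub>G\<^esub> h)))) u = ?r"
  proof (rule extensionalityI[where A = ?B])
    fix h assume h: "h \<in> ?B"
    then have uh: "u h \<in> ?A" using u by auto
    have "compose ?B (\<lambda>x\<in>?A. b (u h \<otimes>\<^bsub>G\<^esub> x)) u = (\<lambda>k\<in>?B. b (u h \<otimes>\<^bsub>G\<^esub> u k))"
      using u by (auto simp: compose_def fun_eq_iff)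
    then show "compose ?B (compose ?A (?t X) (\<lambda>g\<in>?A. c (\<lambda>h\<in>?A. b (g \<otimes>\<^bsub>G\<^esub> h)))) u h = ?r h"
      using h uh by (simp add: compose_eq t[OF X shift])
  qed auto
  moreover have "(\<lambda>g\<in>?B. d (\<lambda>h\<in>?B. compose ?B b u (g \<otimes>\<^bsub>H\<^esub> h))) = ?l"
    by (simp add: compose_eq cong: restrict_cong)
  ultimately have "d ?l = d ?r"
    by (simp add: compose_eq code_in_power b t[OF X b] bu code_in_power[OF shifts] decode_code[OF U(1) X b]
        decode_code[OF U(2) X bu] decode_code[OF U(1) PX shifts]
        t[OF QX compose_PiE[OF shifts tX]])
  \<comment> \<open>This removes the outer layer of coding, for functions into \<open>?Q X\<close>.
    The inner layer, for functions into \<open>X\<close>, is removed below for each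
    \<open>h\<close>.\<close>
  then have "?l = ?r"
    using U(2) QX l r by (auto simp: universe_for_def inj_on_def)
  have "u \<in> hom H G"
  proof (rule homI)
    fix h k assume hk: "h \<in> ?B" "k \<in> ?B"
    have "d (\<lambda>k\<in>?B. b (u (h \<otimes>\<^bsub>H\<^esub> k))) = d (\<lambda>k\<in>?B. b (u h \<otimes>\<^bsub>G\<^esub> u k))"
      using fun_cong[OF \<open>?l = ?r\<close>, of h] hk by simp
    moreover have "(\<lambda>k\<in>?B. b (u (h \<otimes>\<^bsub>H\<^esub> k))) \<in> ?B \<rightarrow>\<^sub>E X" "(\<lambda>k\<in>?B. b (u h \<otimes>\<^bsub>G\<^esub> u k)) \<in> ?B \<rightarrow>\<^sub>E X"
      using u b hk by fastforce+
    ultimately have "(\<lambda>k\<in>?B. b (u (h \<otimes>\<^bsub>H\<^esub> k))) = (\<lambda>k\<in>?B. b (u h \<otimes>\<^bsub>G\<^esub> u k))"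
      using U(2) X by (auto simp: universe_for_def inj_on_def)
    then have "b (u (h \<otimes>\<^bsub>H\<^esub> k)) = b (u h \<otimes>\<^bsub>G\<^esub> u k)"
      using hk by (auto dest!: fun_cong[of _ _ k])
    then show "u (h \<otimes>\<^bsub>H\<^esub> k) = u h \<otimes>\<^bsub>G\<^esub> u k"
      using inj u hk by (auto dest!: inj_onD simp: Pi_iff)
  qed (use u in auto)
  then show ?thesis using t that by blast
qed

text \<open>The composite transformation fixes the code of a bijection \<open>b\<close>, so
  \<open>b\<close> after \<open>u\<close> after \<open>v\<close> is \<open>b\<close>, and
  \<open>b\<close> cancels. Only one composite is treated, since exchanging the roles of the groups
  gives the other.\<close>

lemma Yoneda_maps_inverse:
  assumes U: "universe_for U c (carrier G)"
    and nat: "nat_trans (Sets U) (Fun (group_comonad U c G)) (Fun (group_comonad U d H)) \<phi>"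
      "nat_trans (Sets U) (Fun (group_comonad U d H)) (Fun (group_comonad U c G)) \<psi>"
    and inv: "\<And>X. X \<in> U \<Longrightarrow> vcomp (Sets U) \<psi> \<phi> X = Id (Sets U) (power c (carrier G) X)"
    and u: "u \<in> carrier H \<rightarrow> carrier G" and v: "v \<in> carrier G \<rightarrow> carrier H"
    and s: "\<And>X f. X \<in> U \<Longrightarrow> f \<in> carrier G \<rightarrow>\<^sub>E X \<Longrightarrow>
      fst (snd (\<phi> X)) (c f) = d (compose (carrier H) f u)"
    and t: "\<And>X f. X \<in> U \<Longrightarrow> f \<in> carrier H \<rightarrow>\<^sub>E X \<Longrightarrow>
      fst (snd (\<psi> X)) (d f) = c (compose (carrier G) f v)"
    and x: "x \<in> carrier G"
  shows "u (v x) = x"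
proof -
  let ?A = "carrier G" and ?B = "carrier H"
  obtain X b where X: "X \<in> U" and bij: "bij_betw b ?A X" and b: "b \<in> ?A \<rightarrow>\<^sub>E X"
    by (rule universe_for_bij[OF U])
  have inj: "inj_on b ?A"
    using bij by (rule bij_betw_imp_inj_on)
  have bu: "compose ?B b u \<in> ?B \<rightarrow>\<^sub>E X"
    using u b by (auto simp: compose_def)
  have buv: "compose ?A (compose ?B b u) v \<in> ?A \<rightarrow>\<^sub>E X"
    using v bu by (auto simp: compose_def[of ?A])
  note \<phi>X = nat_trans_group_comonad_component(1)[OF nat(1) X]
  note \<psi>X = nat_trans_group_comonad_component(1)[OF nat(2) X]
  have "Comp (Sets U) (power d ?B X, fst (snd (\<psi> X)), power c ?A X)
      (power c ?A X, fst (snd (\<phi> X)), power d ?B X) = Id (Sets U) (power c ?A X)"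
    using inv[OF X] X by (simp add: vcomp_def Sets_simps(1) flip: \<phi>X \<psi>X)
  then have "compose (power c ?A X) (fst (snd (\<psi> X))) (fst (snd (\<phi> X))) (c b) = c b"
    by (simp add: Sets_simps code_in_power b)
  \<comment> \<open>Only the composition over the power set is evaluated;
    \<open>compose ?B b u\<close> stays intact so that \<open>t\<close> applies to it.\<close>
  then have "c (compose ?A (compose ?B b u) v) = c b"
    by (simp add: compose_eq[of _ "power c ?A X"] code_in_power b s[OF X b] t[OF X bu])
  then have "compose ?A (compose ?B b u) v = b"
    using U X b buv by (auto simp: universe_for_def inj_on_def)
  then have "b (u (v x)) = b x"
    using x funcset_mem[OF v x] by (auto simp: compose_eq dest!: fun_cong[of _ _ x])
  then show ?thesis
    using inj u v x by (auto dest!: inj_onD simp: Pi_iff)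
qed

theorem corollary2:
  fixes G :: "('g, 'm) monoid_scheme" and H :: "('h, 'n) monoid_scheme"
    and U :: "'u set set"
    and c :: "('g \<Rightarrow> 'u) \<Rightarrow> 'u" and d :: "('h \<Rightarrow> 'u) \<Rightarrow> 'u"
  assumes "group G" and "group H"
    and "universe_for U c (carrier G)" and "universe_for U d (carrier H)"
    and "isomorphic_in (Comonads (Sets U)) (group_comonad U c G) (group_comonad U d H)"
  shows "G \<cong> H"
proof -
  let ?S = "Sets U" and ?K = "group_comonad U c G" and ?L = "group_comonad U d H"
  obtain \<phi> \<psi> where mor: "comonad_morphism ?S ?K ?L \<phi>" "comonad_morphism ?S ?L ?K \<psi>"
    and inv: "vcomp ?S \<psi> \<phi> = (\<lambda>X\<in>Obj ?S. Id ?S (FObj (Fun ?K) X))"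
      "vcomp ?S \<phi> \<psi> = (\<lambda>X\<in>Obj ?S. Id ?S (FObj (Fun ?L) X))"
    using assms(5) by (auto simp: isomorphic_in_def arrows_def Comonads_def)
  have nat: "nat_trans ?S (Fun ?K) (Fun ?L) \<phi>" "nat_trans ?S (Fun ?L) (Fun ?K) \<psi>"
    using mor by (simp_all add: comonad_morphism_def)
  obtain u where u: "u \<in> hom H G"
    and s: "\<And>X f. X \<in> U \<Longrightarrow> f \<in> carrier G \<rightarrow>\<^sub>E X \<Longrightarrow>
      fst (snd (\<phi> X)) (c f) = d (compose (carrier H) f u)"
    by (rule comonad_morphism_group_comonad[OF assms(1-4) mor(1)]) blast
  obtain v where v: "v \<in> hom G H"
    and t: "\<And>X f. X \<in> U \<Longrightarrow> f \<in> carrier H \<rightarrow>\<^sub>E X \<Longrightarrow>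
      fst (snd (\<psi> X)) (d f) = c (compose (carrier G) f v)"
    by (rule comonad_morphism_group_comonad[OF assms(2,1,4,3) mor(2)]) blast
  have uv: "u \<in> carrier H \<rightarrow> carrier G" "v \<in> carrier G \<rightarrow> carrier H"
    using u v by (auto simp: hom_def)
  \<comment> \<open>Precomposition reverses order: \<open>\<psi>\<close> after \<open>\<phi>\<close>
    being the identity makes \<open>u\<close> after \<open>v\<close> the identity. Hence the
    isomorphism from \<open>G\<close> to \<open>H\<close> is \<open>v\<close>, which comes from
    \<open>\<psi>\<close>.\<close>
  have "u (v x) = x" if "x \<in> carrier G" for x
    by (rule Yoneda_maps_inverse[where u = u and v = v, OF assms(3) nat _ uv])
      (simp_all add: inv Sets_simps FObj_group_comonad s t that)
  moreover have "v (u y) = y" if "y \<in> carrier H" for y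
    by (rule Yoneda_maps_inverse[where u = v and v = u, OF assms(4) nat(2,1) _ uv(2,1)])
      (simp_all add: inv Sets_simps FObj_group_comonad s t that)
  ultimately have "bij_betw v (carrier G) (carrier H)"
    using uv by (intro bij_betw_byWitness[where f' = u]) auto
  with v show ?thesis
    by (auto simp: is_iso_def iso_def)
qed

end
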